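(* Let $G=(V,E)$ be a finite simple undirected graph on $n\ge 2$ nodes and let $\varepsilon>0$. There exists a set of at most $\lfloor \log_{1+\varepsilon}(n)\rfloor+2$ feasible solutions of the LambdaPrime ILP (respectively, of the LambdaPrime LP relaxation) such that for every $\lambda\in(4/n^2,1)$ the set contains a $(1+\varepsilon)$-approximate solution of the ILP (respectively, of the LP relaxation) for parameter $\lambda$.
   Context: Variables $x_{ij}$ are indexed by unordered pairs $i<j$ of nodes. The LambdaPrime ILP with parameter $\lambda$ is: minimize $\sum_{(i,j)\in E}x_{ij}+\sum_{i<j}\lambda(1-x_{ij})$ subject to $x_{ij}\le x_{ik}+x_{jk}$ for all $i,j,k$, and $x_{ij}\in\{0,1\}$. The LambdaPrime LP relaxation is the same program with $0\le x_{ij}\le 1$ instead of $x_{ij}\in\{0,1\}$. A feasible solution is a $(1+\varepsilon)$-approximate solution for $\lambda$ if its objective value at $\lambda$ is at most $(1+\varepsilon)$ times the optimal value of the corresponding program at $\lambda$. *)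

theory Defs
  imports Complex_Main "HOL-Library.FuncSet" "HOL-Library.Ramsey"
begin

definition simple_graph :: "'a set \<Rightarrow> 'a set set \<Rightarrow> bool" where
  "simple_graph V E \<longleftrightarrow> finite V \<and> E \<subseteq> nsets V 2"

text \<open>A variable \<open>x\<^sub>i\<^sub>j\<close> indexed by an unordered pair of nodes is \<open>x {i, j}\<close>. Assignments are
  extensional, so that a solution is determined by its values on the pairs of nodes and
  cardinalities of sets of solutions are the intended ones.\<close>

definition triangle_inequalities :: "'a set \<Rightarrow> ('a set \<Rightarrow> real) \<Rightarrow> bool" where
  "triangle_inequalities V x \<longleftrightarrow>
     (\<forall>i\<in>V. \<forall>j\<in>V. \<forall>k\<in>V. i \<noteq> j \<and> i \<noteq> k \<and> j \<noteq> k \<longrightarrow> x {i, j} \<le> x {i, k} + x {j, k})"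

definition ilp_feasible :: "'a set \<Rightarrow> ('a set \<Rightarrow> real) set" where
  "ilp_feasible V = {x \<in> nsets V 2 \<rightarrow>\<^sub>E {0, 1}. triangle_inequalities V x}"

definition lp_feasible :: "'a set \<Rightarrow> ('a set \<Rightarrow> real) set" where
  "lp_feasible V = {x \<in> nsets V 2 \<rightarrow>\<^sub>E {0..1}. triangle_inequalities V x}"

definition objective :: "'a set \<Rightarrow> 'a set set \<Rightarrow> real \<Rightarrow> ('a set \<Rightarrow> real) \<Rightarrow> real" where
  "objective V E lam x = (\<Sum>e\<in>E. x e) + (\<Sum>p\<in>nsets V 2. lam * (1 - x p))"

text \<open>The optimal value of the program with feasible region \<open>F\<close>. For the two regions above the
  infimum is a minimum: they are nonempty and compact, and the objective is continuous.\<close>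

definition opt_value :: "'a set \<Rightarrow> 'a set set \<Rightarrow> ('a set \<Rightarrow> real) set \<Rightarrow> real \<Rightarrow> real" where
  "opt_value V E F lam = (INF x\<in>F. objective V E lam x)"

definition approx_solution ::
  "'a set \<Rightarrow> 'a set set \<Rightarrow> ('a set \<Rightarrow> real) set \<Rightarrow> real \<Rightarrow> real \<Rightarrow> ('a set \<Rightarrow> real) \<Rightarrow> bool" where
  "approx_solution V E F \<epsilon> lam x \<longleftrightarrow>
     x \<in> F \<and> objective V E lam x \<le> (1 + \<epsilon>) * opt_value V E F lam"

end

theory Submission
  imports Defs "HOL-Analysis.Function_Topology"
begin

text \<open>Write the objective as \<open>A x + \<lambda> B x\<close> with \<open>A x, B x \<ge> 0\<close>. Its value at a fixed \<open>x\<close> is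
  nondecreasing in \<open>\<lambda>\<close> and grows by at most a factor \<open>c \<ge> 1\<close> when \<open>\<lambda>\<close> does. Hence an optimal
  solution at \<open>\<mu>\<close> is \<open>(1 + \<epsilon>)\<close>-approximate on all of \<open>[\<mu> / (1 + \<epsilon>), \<mu> (1 + \<epsilon>)]\<close>, and optimal
  solutions at the odd powers of \<open>1 / (1 + \<epsilon>)\<close> cover ratios of \<open>(1 + \<epsilon>)\<^sup>2\<close> each, so that about
  \<open>log\<^bsub>(1 + \<epsilon>)\<^sup>2\<^esub> (n\<^sup>2) = log\<^bsub>1 + \<epsilon>\<^esub> n\<close> of them suffice.\<close>

text \<open>The edge sum is nonnegative, so scaling by \<open>c\<close> only enlarges it, and the
  other sum is linear in the parameter with nonnegative coefficients. Taking \<open>c = 1\<close>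
  gives monotonicity, \<open>c = 1 + \<epsilon>\<close> the growth bound.\<close>

lemma objective_le_mult:
  assumes "simple_graph V E" "x \<in> lp_feasible V" "1 \<le> c" "l \<le> c * m"
  shows "objective V E l x \<le> c * objective V E m x"
proof -
  have x01: "0 \<le> x p" "x p \<le> 1" if "p \<in> nsets V 2" for p
    using assms(2) that by (auto simp: lp_feasible_def PiE_iff)
  have "0 \<le> (\<Sum>e\<in>E. x e)"
    using assms(1) by (intro sum_nonneg x01) (auto simp: simple_graph_def)
  then have edges: "(\<Sum>e\<in>E. x e) \<le> c * (\<Sum>e\<in>E. x e)"
    using assms(3) by (simp add: mult_le_cancel_right1)
  have "(\<Sum>p\<in>nsets V 2. l * (1 - x p)) \<le> (\<Sum>p\<in>nsets V 2. (c * m) * (1 - x p))"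
    using assms(4) x01 by (intro sum_mono mult_right_mono) auto
  also have "\<dots> = c * (\<Sum>p\<in>nsets V 2. m * (1 - x p))"
    by (simp add: sum_distrib_left mult.assoc)
  finally show ?thesis
    using edges by (simp add: objective_def distrib_left)
qed

text \<open>Pass from \<open>x\<close> at \<open>l\<close> to \<open>x\<close> at \<open>m\<close>,
  by optimality to \<open>y\<close> at \<open>m\<close>, then to \<open>y\<close> at
  \<open>l\<close>. Whichever of \<open>l\<close>, \<open>m\<close> is larger, only one change of
  parameter costs the factor \<open>1 + \<epsilon>\<close>; the other is monotonicity.\<close>

lemma optimal_imp_approx_solution:
  assumes "simple_graph V E" "F \<subseteq> lp_feasible V" "x \<in> F" "\<epsilon> \<ge> 0"
    and opt: "\<And>y. y \<in> F \<Longrightarrow> objective V E m x \<le> objective V E m y"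
    and l: "l \<le> (1 + \<epsilon>) * m" and m: "m \<le> (1 + \<epsilon>) * l"
  shows "approx_solution V E F \<epsilon> l x"
proof -
  have "objective V E l x \<le> (1 + \<epsilon>) * objective V E l y" if "y \<in> F" for y
  proof (cases "m \<le> l")
    case True
    have "objective V E l x \<le> (1 + \<epsilon>) * objective V E m x"
      using assms by (intro objective_le_mult) auto
    also have "\<dots> \<le> (1 + \<epsilon>) * objective V E m y"
      using opt[OF that] assms(4) by (intro mult_left_mono) auto
    also have "\<dots> \<le> (1 + \<epsilon>) * (1 * objective V E l y)"
      using assms that True by (intro mult_left_mono objective_le_mult) auto
    finally show ?thesis by simp
  next
    case False
    then have "objective V E l x \<le> 1 * objective V E m x"
      using assms by (intro objective_le_mult) auto
    also have "\<dots> \<le> objective V E m y"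
      using opt[OF that] by simp
    also have "\<dots> \<le> (1 + \<epsilon>) * objective V E l y"
      using assms that by (intro objective_le_mult) auto
    finally show ?thesis .
  qed
  \<comment> \<open>As \<open>y\<close> was arbitrary, the scaled value is a lower bound on
    \<open>F\<close>, hence at most the infimum; no minimizer at \<open>l\<close> is
    required.\<close>
  then have "objective V E l x / (1 + \<epsilon>) \<le> opt_value V E F l"
    unfolding opt_value_def using assms(3,4)
    by (intro cINF_greatest) (auto simp: field_simps)
  then show ?thesis
    using assms(3,4) by (simp add: approx_solution_def field_simps)
qed

lemma compact_triangle_inequalities:
  fixes K :: "real set"
  assumes "compact K"
  shows "compact {x \<in> nsets V 2 \<rightarrow>\<^sub>E K. triangle_inequalities V x}"
proof -
  \<comment> \<open>Singleton factors off the pairs encode extensionality, which turns the set into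
    a full product to which Tychonoff's theorem applies.\<close>
  let ?K = "\<lambda>p. if p \<in> nsets V 2 then K else {undefined}"
  have "compactin (product_topology (\<lambda>_. euclidean) UNIV) (PiE UNIV ?K)"
    using assms by (auto simp: compactin_PiE)
  then have "compact (PiE UNIV ?K)"
    by (simp add: euclidean_product_topology)
  moreover have "PiE UNIV ?K = nsets V 2 \<rightarrow>\<^sub>E K"
    by (auto simp: PiE_iff extensional_def split: if_splits)
  moreover have "closed {x. triangle_inequalities V x}"
    unfolding triangle_inequalities_def Ball_def
    by (intro closed_Collect_all closed_Collect_imp closed_Collect_le
        continuous_on_add continuous_on_product_coordinates open_Collect_const)
  ultimately have "compact ((nsets V 2 \<rightarrow>\<^sub>E K) \<inter> {x. triangle_inequalities V x})"
    by (simp add: compact_Int_closed)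
  then show ?thesis
    by (simp add: Int_def)
qed

lemma continuous_on_objective: "continuous_on S (objective V E l)"
  unfolding objective_def
  by (intro continuous_intros continuous_on_subset[OF continuous_on_product_coordinates subset_UNIV])

text \<open>With \<open>l = q powr (- t)\<close> and \<open>k\<close> the floor of
  \<open>t / 2\<close>, we have \<open>2 * k <= t < 2 * k + 2\<close>, so the exponents
  \<open>t\<close> and \<open>2 * k + 1\<close> differ by at most 1.\<close>

lemma geometric_cover:
  fixes q l :: real
  assumes "1 < q" "1 \<le> n" "4 / (real n)\<^sup>2 < l" "l < 1"
  obtains k :: int where "k \<in> {0..\<lfloor>log q (real n)\<rfloor>}"
    "l \<le> q * q powr (- (2 * k + 1))" "q powr (- (2 * k + 1)) \<le> q * l"
proof
  define t where "t = - log q l"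
  have "0 < 4 / (real n)\<^sup>2" using assms(2) by simp
  then have "0 < l" using assms(3) by linarith
  then have l_eq: "l = q powr (- t)" using assms(1) by (simp add: t_def)
  have "0 < t" using assms \<open>0 < l\<close> by (simp add: t_def)
  \<comment> \<open>Logarithms turn this into \<open>t < 2 * log q n\<close>, which bounds the index
    \<open>k\<close>.\<close>
  have "1 / (real n)\<^sup>2 < l"
    using assms(2,3) by (smt (verit) divide_right_mono zero_le_power2)
  then have "log q (1 / (real n)\<^sup>2) < log q l"
    using assms \<open>0 < l\<close> by simp
  then have "t / 2 < log q n"
    using assms by (simp add: t_def log_divide log_nat_power)
  then show "\<lfloor>t / 2\<rfloor> \<in> {0..\<lfloor>log q (real n)\<rfloor>}"
    using \<open>0 < t\<close> by (auto intro: floor_mono)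
  have q_powr: "q * q powr s = q powr (1 + s)" for s
    using assms(1) by (simp add: powr_add)
  show "l \<le> q * q powr (- (2 * \<lfloor>t / 2\<rfloor> + 1))"
    unfolding l_eq q_powr using assms(1) by (intro powr_mono) linarith+
  show "q powr (- (2 * \<lfloor>t / 2\<rfloor> + 1)) \<le> q * l"
    unfolding l_eq q_powr using assms(1) by (intro powr_mono) linarith+
qed

text \<open>Keeping \<open>F\<close> abstract treats both programs at once; compactness supplies a
  minimizer for each parameter.\<close>

lemma approx_solution_cover:
  fixes n :: nat and \<epsilon> :: real
  assumes "simple_graph V E" "F \<subseteq> lp_feasible V" "compact F" "F \<noteq> {}" "1 \<le> n" "0 < \<epsilon>"
  obtains S where "S \<subseteq> F" "finite S" "int (card S) \<le> \<lfloor>log (1 + \<epsilon>) (real n)\<rfloor> + 1"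
    "\<And>l. 4 / (real n)\<^sup>2 < l \<Longrightarrow> l < 1 \<Longrightarrow> \<exists>x\<in>S. approx_solution V E F \<epsilon> l x"
proof -
  have "\<exists>x\<in>F. \<forall>y\<in>F. objective V E m x \<le> objective V E m y" for m
    using assms(3,4) continuous_on_objective by (rule continuous_attains_inf)
  then obtain opt where opt: "opt m \<in> F" "\<And>y. y \<in> F \<Longrightarrow> objective V E m (opt m) \<le> objective V E m y" for m
    by metis
  let ?I = "{0..\<lfloor>log (1 + \<epsilon>) (real n)\<rfloor>}"
  let ?opt = "\<lambda>k::int. opt ((1 + \<epsilon>) powr (- (2 * k + 1)))"
  show thesis
  proof
    show "?opt ` ?I \<subseteq> F" "finite (?opt ` ?I)"
      using opt(1) by auto
    have "card (?opt ` ?I) \<le> card ?I"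
      by (rule card_image_le) simp
    \<comment> \<open>Nonnegativity keeps the cardinality of the integer interval from being
      truncated at 0.\<close>
    moreover have "0 \<le> \<lfloor>log (1 + \<epsilon>) (real n)\<rfloor>"
      using assms(5,6) by simp
    then have "int (card ?I) = \<lfloor>log (1 + \<epsilon>) (real n)\<rfloor> + 1"
      by simp
    ultimately show "int (card (?opt ` ?I)) \<le> \<lfloor>log (1 + \<epsilon>) (real n)\<rfloor> + 1"
      by linarith
    fix l :: real
    assume "4 / (real n)\<^sup>2 < l" "l < 1"
    then obtain k where k: "k \<in> ?I" "l \<le> (1 + \<epsilon>) * (1 + \<epsilon>) powr (- (2 * k + 1))"
      "(1 + \<epsilon>) powr (- (2 * k + 1)) \<le> (1 + \<epsilon>) * l"
      using geometric_cover[of "1 + \<epsilon>" n l] assms(5,6) by auto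
    have "approx_solution V E F \<epsilon> l (?opt k)"
      using assms(6) k(2,3)
      by (intro optimal_imp_approx_solution[OF assms(1,2) opt(1) _ opt(2)]) auto
    then show "\<exists>x\<in>?opt ` ?I. approx_solution V E F \<epsilon> l x"
      using k(1) by blast
  qed
qed

theorem theorem3:
  fixes V :: "'a set" and E :: "'a set set" and n :: nat and \<epsilon> :: real
  assumes "simple_graph V E" and "card V = n" and "n \<ge> 2" and "\<epsilon> > 0"
  shows "(\<exists>S. S \<subseteq> ilp_feasible V \<and> finite S \<and> int (card S) \<le> \<lfloor>log (1 + \<epsilon>) (real n)\<rfloor> + 2 \<and>
            (\<forall>lam::real. 4 / (real n)\<^sup>2 < lam \<and> lam < 1 \<longrightarrow>
               (\<exists>x\<in>S. approx_solution V E (ilp_feasible V) \<epsilon> lam x))) \<and>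
         (\<exists>S. S \<subseteq> lp_feasible V \<and> finite S \<and> int (card S) \<le> \<lfloor>log (1 + \<epsilon>) (real n)\<rfloor> + 2 \<and>
            (\<forall>lam::real. 4 / (real n)\<^sup>2 < lam \<and> lam < 1 \<longrightarrow>
               (\<exists>x\<in>S. approx_solution V E (lp_feasible V) \<epsilon> lam x)))"
proof -
  have cover: "\<exists>S. S \<subseteq> F \<and> finite S \<and> int (card S) \<le> \<lfloor>log (1 + \<epsilon>) (real n)\<rfloor> + 2 \<and>
      (\<forall>lam::real. 4 / (real n)\<^sup>2 < lam \<and> lam < 1 \<longrightarrow> (\<exists>x\<in>S. approx_solution V E F \<epsilon> lam x))"
    if F: "F \<subseteq> lp_feasible V" "compact F" "F \<noteq> {}" for F
  proof -
    obtain S where "S \<subseteq> F" "finite S" "int (card S) \<le> \<lfloor>log (1 + \<epsilon>) (real n)\<rfloor> + 1"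
      "\<And>l. 4 / (real n)\<^sup>2 < l \<Longrightarrow> l < 1 \<Longrightarrow> \<exists>x\<in>S. approx_solution V E F \<epsilon> l x"
      using approx_solution_cover[OF assms(1) F _ assms(4), of n] assms(3) by auto
    then show ?thesis
      by (intro exI[of _ S]) auto
  qed
  have sub: "ilp_feasible V \<subseteq> lp_feasible V"
    by (auto simp: ilp_feasible_def lp_feasible_def PiE_iff)
  \<comment> \<open>The zero assignment witnesses that both regions are nonempty.\<close>
  have "(\<lambda>p\<in>nsets V 2. 0) \<in> ilp_feasible V"
    by (auto simp: ilp_feasible_def triangle_inequalities_def nsets_def card_2_iff)
  then have "ilp_feasible V \<noteq> {}" "lp_feasible V \<noteq> {}"
    using sub by auto
  then show ?thesis
    using sub by (intro conjI cover)
      (auto simp: ilp_feasible_def lp_feasible_def intro!: compact_triangle_inequalities)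
qed

end
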